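(* Let $\rho_{AB}$ be a two-qubit state with Bloch parameters $(\boldsymbol a,\boldsymbol b,T)$, $\boldsymbol b\neq0$, and $\boldsymbol n_B=\boldsymbol b/|\boldsymbol b|$. Then $$\mathcal R_{KD}(\rho_{AB})=0\quad\Longleftrightarrow\quad T=\boldsymbol d\,\boldsymbol n_B^T\ \text{ for some }\boldsymbol d\in\mathbb R^3 .$$ The same condition is also equivalent to $\mathcal C_{KD}(\rho_{AB})=0$.
   Context: A two-qubit state is written $\rho_{AB}=\tfrac14\big[\mathbb I\otimes\mathbb I+\boldsymbol a\cdot\boldsymbol\sigma\otimes\mathbb I+\mathbb I\otimes\boldsymbol b\cdot\boldsymbol\sigma+\sum_{i,j=1}^3T_{ij}\,\sigma_i\otimes\sigma_j\big]$, with $\boldsymbol a,\boldsymbol b\in\mathbb R^3$ the local Bloch vectors and $T$ a real $3\times3$ matrix (first index Alice's, second Bob's). KD nonclassicality: the first (reference) basis is the eigenbasis of $\boldsymbol n_B\cdot\boldsymbol\sigma$, with projectors $\Pi_0,\Pi_1$. For an orthonormal qubit basis $\{|b_k\rangle\}_{k=0,1}$ and a qubit state $\rho$, put $Q_{ik}(\rho)=\mathrm{Tr}(|b_k\rangle\langle b_k|\,\Pi_i\,\rho)$, and define $\mathcal N_{KD}(\rho)=\max_{\{|b_k\rangle\}}\tfrac12\big(\sum_{i,k}|Q_{ik}(\rho)|-1\big)$, the maximum over all orthonormal qubit bases with $\boldsymbol n_B$ fixed. For a POVM $\{M_a\}$ on Alice's qubit, $p(a)=\mathrm{Tr}[(M_a\otimes\mathbb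 I)\rho_{AB}]$ and, if $p(a)>0$, $\rho_{B|a}=\mathrm{Tr}_A[(M_a\otimes\mathbb I)\rho_{AB}]/p(a)$. Then $\mathcal R_{KD}(\rho_{AB})=\max_{\{M_a\},a}\mathcal N_{KD}(\rho_{B|a})$ (all POVMs, all outcomes of nonzero probability) and $\mathcal C_{KD}(\rho_{AB})=\max_{\{M_a\}}\sum_ap(a)\,\mathcal N_{KD}(\rho_{B|a})$ (all POVMs). *)

theory Defs
  imports "HOL-Analysis.Analysis"
begin

type_synonym qubit_vec = "complex ^ 2"
type_synonym qubit_op = "complex ^ 2 ^ 2"

text \<open>Operators on the two-qubit space; an index is a pair (Alice's index, Bob's index).\<close>
type_synonym two_qubit_op = "complex ^ (2 \<times> 2) ^ (2 \<times> 2)"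


subsection \<open>States\<close>

definition cinner :: "complex ^ 'n \<Rightarrow> complex ^ 'n \<Rightarrow> complex" where
  "cinner u v = (\<Sum>i\<in>UNIV. cnj (u $ i) * v $ i)"

definition adjoint_mat :: "complex ^ 'n ^ 'm \<Rightarrow> complex ^ 'm ^ 'n" where
  "adjoint_mat A = (\<chi> i j. cnj (A $ j $ i))"

definition positive_semidef :: "complex ^ 'n ^ 'n \<Rightarrow> bool" where
  "positive_semidef A \<longleftrightarrow> adjoint_mat A = A \<and> (\<forall>v. 0 \<le> Re (cinner v (A *v v)))"

definition is_state :: "complex ^ 'n ^ 'n \<Rightarrow> bool" where
  "is_state \<rho> \<longleftrightarrow> positive_semidef \<rho> \<and> trace \<rho> = 1"

definition kron :: "qubit_op \<Rightarrow> qubit_op \<Rightarrow> two_qubit_op" where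
  "kron A B = (\<chi> i j. A $ fst i $ fst j * B $ snd i $ snd j)"

definition ptrace_A :: "two_qubit_op \<Rightarrow> qubit_op" where
  "ptrace_A X = (\<chi> i j. \<Sum>k\<in>UNIV. X $ (k, i) $ (k, j))"

definition pauli :: "3 \<Rightarrow> qubit_op" where
  "pauli i =
    (if i = 1 then vector [vector [0, 1], vector [1, 0]]
     else if i = 2 then vector [vector [0, - \<i>], vector [\<i>, 0]]
     else vector [vector [1, 0], vector [0, - 1]])"

definition pauli_vec :: "real ^ 3 \<Rightarrow> qubit_op" where
  "pauli_vec r = (\<Sum>i\<in>UNIV. r $ i *\<^sub>R pauli i)"

definition bloch_op :: "real ^ 3 \<Rightarrow> real ^ 3 \<Rightarrow> real ^ 3 ^ 3 \<Rightarrow> two_qubit_op" where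
  "bloch_op a b T = (1 / 4) *\<^sub>R
    (kron (mat 1) (mat 1) + kron (pauli_vec a) (mat 1) + kron (mat 1) (pauli_vec b)
      + (\<Sum>i\<in>UNIV. \<Sum>j\<in>UNIV. T $ i $ j *\<^sub>R kron (pauli i) (pauli j)))"


subsection \<open>Kirkwood--Dirac nonclassicality\<close>

definition orthonormal_basis :: "(2 \<Rightarrow> qubit_vec) \<Rightarrow> bool" where
  "orthonormal_basis b \<longleftrightarrow> (\<forall>k l. cinner (b k) (b l) = (if k = l then 1 else 0))"

definition eigenbasis :: "qubit_op \<Rightarrow> (2 \<Rightarrow> qubit_vec) \<Rightarrow> bool" where
  "eigenbasis A e \<longleftrightarrow> orthonormal_basis e \<and> (\<forall>i. \<exists>c. A *v e i = c *s e i)"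

definition ketbra :: "qubit_vec \<Rightarrow> qubit_op" where
  "ketbra v = (\<chi> i j. v $ i * cnj (v $ j))"

definition KD :: "(2 \<Rightarrow> qubit_vec) \<Rightarrow> (2 \<Rightarrow> qubit_vec) \<Rightarrow> qubit_op \<Rightarrow> 2 \<Rightarrow> 2 \<Rightarrow> complex" where
  "KD e b \<rho> i k = trace (ketbra (b k) ** ketbra (e i) ** \<rho>)"

text \<open>
  The argument \<open>e\<close> is the reference basis. The maxima are rendered as suprema of sets of reals;
  for states \<open>\<rho>\<close> and orthonormal \<open>e\<close> these sets are nonempty and bounded above.
\<close>

definition N_KD :: "(2 \<Rightarrow> qubit_vec) \<Rightarrow> qubit_op \<Rightarrow> real" where
  "N_KD e \<rho> =
    (SUP b\<in>{b. orthonormal_basis b}. ((\<Sum>i\<in>UNIV. \<Sum>k\<in>UNIV. cmod (KD e b \<rho> i k)) - 1) / 2)"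


subsection \<open>Steering by measurements on Alice's qubit\<close>

text \<open>A POVM with outcomes \<open>0, \<dots>, n - 1\<close>.\<close>
definition is_povm :: "nat \<Rightarrow> (nat \<Rightarrow> qubit_op) \<Rightarrow> bool" where
  "is_povm n M \<longleftrightarrow> (\<forall>k<n. positive_semidef (M k)) \<and> (\<Sum>k<n. M k) = mat 1"

text \<open>The trace below is a real number when \<open>E\<close> and \<open>\<rho>\<close> are Hermitian.\<close>
definition outcome_prob :: "two_qubit_op \<Rightarrow> qubit_op \<Rightarrow> real" where
  "outcome_prob \<rho> E = Re (trace (kron E (mat 1) ** \<rho>))"

definition steered_state :: "two_qubit_op \<Rightarrow> qubit_op \<Rightarrow> qubit_op" where
  "steered_state \<rho> E = (1 / outcome_prob \<rho> E) *\<^sub>R ptrace_A (kron E (mat 1) ** \<rho>)"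

definition R_KD :: "(2 \<Rightarrow> qubit_vec) \<Rightarrow> two_qubit_op \<Rightarrow> real" where
  "R_KD e \<rho> =
    Sup {N_KD e (steered_state \<rho> (M k)) | n M k.
          is_povm n M \<and> k < n \<and> outcome_prob \<rho> (M k) > 0}"

text \<open>Outcomes of probability zero contribute zero to the sum.\<close>
definition C_KD :: "(2 \<Rightarrow> qubit_vec) \<Rightarrow> two_qubit_op \<Rightarrow> real" where
  "C_KD e \<rho> =
    Sup {(\<Sum>k<n. outcome_prob \<rho> (M k) * N_KD e (steered_state \<rho> (M k))) | n M. is_povm n M}"

end

theory Submission
  imports Defs
begin

text \<open>
  The values \<open>KD e b \<rho> i k\<close> of a state sum to 1, so \<open>N_KD e \<rho>\<close> is nonnegative and vanishes iff they
  are nonnegative reals for every basis \<open>b\<close>. This holds when \<open>\<rho>\<close> is diagonal in \<open>e\<close>; conversely a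
  nonzero off-diagonal entry of \<open>\<rho>\<close> gives a non-real value for the basis of normalized \<open>e 1 \<plusminus> w e 2\<close> with a
  suitable phase \<open>w\<close>. An operator is diagonal in the eigenbasis of \<open>pauli_vec n\<close> iff it commutes with
  it, that is, iff its Bloch vector is parallel to \<open>n\<close>. An effect with trace \<open>t\<close> and Bloch
  coordinates \<open>m\<close> steers Bob to a Bloch vector proportional to \<open>t b + T\<^sup>T m\<close>. As \<open>b\<close> is parallel to
  \<open>n\<close>, both vanishing conditions say that \<open>T\<^sup>T m\<close> is parallel to \<open>n\<close> for all \<open>m\<close>, and it suffices to
  test the measurements of the three Pauli observables, which give the rows of \<open>T\<close>.
\<close>

section \<open>Inner products and orthonormal bases\<close>

lemma sum_UNIV_prod:
  fixes f :: "'a::finite \<times> 'b::finite \<Rightarrow> 'c::comm_monoid_add"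
  shows "(\<Sum>p\<in>UNIV. f p) = (\<Sum>i\<in>UNIV. \<Sum>j\<in>UNIV. f (i, j))"
  by (simp add: sum.cartesian_product flip: UNIV_Times_UNIV)

lemma cnj_cinner: "cnj (cinner u v) = cinner v u"
  by (simp add: cinner_def mult.commute)

lemma cinner_adjoint: "cinner (adjoint_mat A *v u) v = cinner u (A *v v)"
proof -
  have "cinner (adjoint_mat A *v u) v = (\<Sum>i\<in>UNIV. \<Sum>j\<in>UNIV. A $ j $ i * cnj (u $ j) * v $ i)"
    by (simp add: cinner_def adjoint_mat_def matrix_vector_mult_def sum_distrib_right)
  also have "\<dots> = (\<Sum>j\<in>UNIV. \<Sum>i\<in>UNIV. A $ j $ i * cnj (u $ j) * v $ i)"
    by (rule sum.swap)
  also have "\<dots> = cinner u (A *v v)"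
    by (simp add: cinner_def matrix_vector_mult_def sum_distrib_left mult_ac)
  finally show ?thesis .
qed

text \<open>With the basis vectors as columns of \<open>B\<close>, orthonormality says that
  \<open>adjoint_mat B\<close> is a left inverse; for a square matrix it is then a right inverse
  too.\<close>

lemma orthonormal_basis_resolution:
  assumes "orthonormal_basis b"
  shows "(\<Sum>k\<in>UNIV. ketbra (b k)) = mat 1"
proof -
  define B :: qubit_op where "B = (\<chi> i k. b k $ i)"
  have "adjoint_mat B ** B = mat 1"
    using assms
    by (simp add: B_def orthonormal_basis_def cinner_def adjoint_mat_def matrix_matrix_mult_def
        mat_def vec_eq_iff)
  then have "B ** adjoint_mat B = mat 1"
    by (simp add: matrix_left_right_inverse)
  then show ?thesis
    by (simp add: B_def ketbra_def adjoint_mat_def matrix_matrix_mult_def vec_eq_iff)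
qed

lemma orthonormal_basis_component_le:
  assumes "orthonormal_basis b"
  shows "cmod (b k $ i) \<le> 1"
proof -
  have "of_real ((cmod (b k $ 1))\<^sup>2 + (cmod (b k $ 2))\<^sup>2) = (1::complex)"
    using assms by (simp add: orthonormal_basis_def cinner_def sum_2 complex_norm_square mult.commute
       flip: of_real_power)
  then have "(cmod (b k $ 1))\<^sup>2 + (cmod (b k $ 2))\<^sup>2 = 1"
    using of_real_eq_1_iff by blast
  then have "\<forall>i. (cmod (b k $ i))\<^sup>2 \<le> 1"
    unfolding forall_2
    using zero_le_power2[of "cmod (b k $ 1)"] zero_le_power2[of "cmod (b k $ 2)"] by linarith
  then have "(cmod (b k $ i))\<^sup>2 \<le> 1" by blast
  then show ?thesis
    by (simp add: power2_le_iff_abs_le power_le_one_iff)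
qed

section \<open>The Kirkwood-Dirac values and their sum\<close>

lemma KD_eq: "KD e b \<rho> i k = cinner (b k) (e i) * cinner (e i) (\<rho> *v b k)"
  by (simp add: KD_def trace_def ketbra_def matrix_matrix_mult_def cinner_def
      matrix_vector_mult_def sum_2 algebra_simps)

text \<open>Summing over \<open>k\<close> and then over \<open>i\<close> removes both projectors by
  the resolution of the identity.\<close>

lemma sum_KD:
  assumes "orthonormal_basis e" "orthonormal_basis b"
  shows "(\<Sum>i\<in>UNIV. \<Sum>k\<in>UNIV. KD e b \<rho> i k) = trace \<rho>"
proof -
  have distr: "(B + C) ** A = B ** A + C ** A" for A B C :: qubit_op
    by (simp add: matrix_matrix_mult_def vec_eq_iff algebra_simps sum.distrib)
  have *: "(\<Sum>k\<in>UNIV. trace (ketbra (b k) ** A)) = trace ((\<Sum>k\<in>UNIV. ketbra (b k)) ** A)"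
    for A and b :: "2 \<Rightarrow> qubit_vec"
    by (simp add: sum_2 distr trace_add)
  have "(\<Sum>i\<in>UNIV. \<Sum>k\<in>UNIV. KD e b \<rho> i k) = (\<Sum>i\<in>UNIV. trace (ketbra (e i) ** \<rho>))"
    unfolding KD_def
    by (simp add: * orthonormal_basis_resolution[OF assms(2)] flip: matrix_mul_assoc)
  also have "\<dots> = trace \<rho>"
    by (simp add: * orthonormal_basis_resolution[OF assms(1)])
  finally show ?thesis .
qed

section \<open>Positive semidefinite qubit operators\<close>

lemma positive_semidef_entry:
  "positive_semidef A \<Longrightarrow> cnj (A $ i $ j) = A $ j $ i"
  by (metis (no_types, lifting) adjoint_mat_def positive_semidef_def vec_lambda_beta)

lemma positive_semidef_form_2:
  fixes A :: qubit_op
  assumes "positive_semidef A"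
  shows "0 \<le> (cmod x)\<^sup>2 * Re (A $ 1 $ 1) + (cmod y)\<^sup>2 * Re (A $ 2 $ 2) + 2 * Re (cnj x * y * A $ 1 $ 2)"
proof -
  have h: "A $ 2 $ 1 = cnj (A $ 1 $ 2)"
    using positive_semidef_entry[OF assms] by simp
  have r: "Im (A $ i $ i) = 0" for i
    using positive_semidef_entry[OF assms, of i i] by (simp add: complex_eq_iff)
  have "0 \<le> Re (cinner (vector [x, y]) (A *v vector [x, y]))"
    using assms unfolding positive_semidef_def by blast
  also have "\<dots> = (cmod x)\<^sup>2 * Re (A $ 1 $ 1) + (cmod y)\<^sup>2 * Re (A $ 2 $ 2) + 2 * Re (cnj x * y * A $ 1 $ 2)"
    unfolding cmod_power2 using r[of 1] r[of 2]
    by (simp add: cinner_def matrix_vector_mult_def sum_2 h power2_eq_square algebra_simps)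
  finally show ?thesis .
qed

lemma positive_semidef_diag:
  fixes A :: qubit_op
  assumes "positive_semidef A"
  shows "A $ i $ i = of_real (Re (A $ i $ i))" "0 \<le> Re (A $ i $ i)"
proof -
  show "A $ i $ i = of_real (Re (A $ i $ i))"
    using positive_semidef_entry[OF assms, of i i] by (simp add: complex_eq_iff)
  show "0 \<le> Re (A $ i $ i)"
    using positive_semidef_form_2[OF assms, of 1 0] positive_semidef_form_2[OF assms, of 0 1]
      exhaust_2[of i] by auto
qed

text \<open>The determinant is nonnegative because the quadratic form is nonnegative on suitably
  chosen vectors.\<close>

lemma positive_semidef_det:
  fixes A :: qubit_op
  assumes "positive_semidef A"
  shows "(cmod (A $ 1 $ 2))\<^sup>2 \<le> Re (A $ 1 $ 1) * Re (A $ 2 $ 2)"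
proof -
  define p q r where "p = Re (A $ 1 $ 1)" and "q = A $ 1 $ 2" and "r = Re (A $ 2 $ 2)"
  have pr: "0 \<le> p" "0 \<le> r" unfolding p_def r_def using positive_semidef_diag[OF assms] by auto
  have f: "0 \<le> (cmod x)\<^sup>2 * p + (cmod y)\<^sup>2 * r + 2 * Re (cnj x * y * q)" for x y
    using positive_semidef_form_2[OF assms] unfolding p_def q_def r_def .
  \<comment> \<open>The vector \<open>(s q, - t)\<close> cancels the phase of \<open>q\<close>,
    which leaves a real form in \<open>s\<close> and \<open>t\<close>.\<close>
  have *: "0 \<le> s\<^sup>2 * (cmod q)\<^sup>2 * p + t\<^sup>2 * r - 2 * s * t * (cmod q)\<^sup>2" for s t :: real
    using f[of "of_real s * q" "- of_real t"]
    by (simp add: power2_eq_square cmod_power2[unfolded power2_eq_square] algebra_simps norm_mult)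
  have "(cmod q)\<^sup>2 \<le> p * r"
  proof (cases "p = 0")
    case True
    have "q = 0"
    proof (rule ccontr)
      assume "q \<noteq> 0"
      then show False
        \<comment> \<open>At this point the form has the value \<open>r - 2 * (r + 1)\<close>, which
          is negative.\<close>
        using *[of "(r + 1) / (cmod q)\<^sup>2" 1] pr True by simp
    qed
    with True show ?thesis by simp
  next
    case False
    have "0 \<le> p * (p * r - (cmod q)\<^sup>2)"
      using *[of 1 p] by (simp add: algebra_simps power2_eq_square)
    with False pr show ?thesis by (simp add: zero_le_mult_iff)
  qed
  then show ?thesis by (simp add: p_def q_def r_def)
qed

lemma state_entry_le:
  fixes A :: qubit_op
  assumes "is_state A"
  shows "cmod (A $ i $ j) \<le> 1"
proof -
  have A: "positive_semidef A" and t: "A $ 1 $ 1 + A $ 2 $ 2 = 1"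
    using assms by (auto simp: is_state_def trace_def sum_2)
  have t: "Re (A $ 1 $ 1) + Re (A $ 2 $ 2) = 1"
    using arg_cong[OF t, of Re] by simp
  have d: "cmod (A $ k $ k) = Re (A $ k $ k)" "0 \<le> Re (A $ k $ k)" for k
    using positive_semidef_diag[OF A, of k] by (metis norm_of_real abs_of_nonneg)+
  have le: "Re (A $ 1 $ 1) \<le> 1" "Re (A $ 2 $ 2) \<le> 1"
    using t d(2)[of 1] d(2)[of 2] by linarith+
  have "(cmod (A $ 1 $ 2))\<^sup>2 \<le> 1 * 1"
    using positive_semidef_det[OF A] mult_mono[OF le] d(2)[of 2] by linarith
  then have o: "cmod (A $ 1 $ 2) \<le> 1"
    by (simp add: power2_le_iff_abs_le power_le_one_iff)
  have "cmod (A $ 2 $ 1) = cmod (A $ 1 $ 2)"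
    using positive_semidef_entry[OF A, of 1 2] by (metis complex_mod_cnj)
  with o le d show ?thesis
    using exhaust_2[of i] exhaust_2[of j] by auto
qed

text \<open>Reduces positivity of the operators steered by an arbitrary effect to the case of
  rank-one effects.\<close>

lemma positive_semidef_sum_ketbra:
  fixes A :: qubit_op
  assumes "positive_semidef A"
  shows "\<exists>u v. A = ketbra u + ketbra v"
proof -
  define p q r where "p = Re (A $ 1 $ 1)" and "q = A $ 1 $ 2" and "r = Re (A $ 2 $ 2)"
  have pr: "0 \<le> p" "0 \<le> r" unfolding p_def r_def using positive_semidef_diag[OF assms] by auto
  have A: "A $ 1 $ 1 = of_real p" "A $ 2 $ 2 = of_real r" "A $ 1 $ 2 = q" "A $ 2 $ 1 = cnj q"
    unfolding p_def q_def r_def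
    using positive_semidef_diag(1)[OF assms] positive_semidef_entry[OF assms, of 1 2] by auto
  have D: "(cmod q)\<^sup>2 \<le> p * r"
    using positive_semidef_det[OF assms] by (simp add: p_def q_def r_def)
  have sq: "complex_of_real (sqrt x) * complex_of_real (sqrt x) = of_real x" if "0 \<le> x" for x
    using that by (metis of_real_mult real_sqrt_mult_self abs_of_nonneg)
  show ?thesis
  proof (cases "p = 0")
    case True
    then have "q = 0" using D by simp
    then have "A = ketbra (vector [0, of_real (sqrt r)]) + ketbra 0"
      by (simp add: vec_eq_iff forall_2 ketbra_def A True sq pr)
    then show ?thesis by blast
  next
    case False
    then have p: "0 < p" using pr by simp
    \<comment> \<open>Cholesky decomposition: \<open>w\<close> is the Schur complement of the entry \<open>p\<close>.\<close>
    define w where "w = r - (cmod q)\<^sup>2 / p"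
    have qq: "cnj q * q = of_real ((cmod q)\<^sup>2)" "q * cnj q = of_real ((cmod q)\<^sup>2)"
      using complex_norm_square[of q] by (simp_all add: mult.commute)
    have w: "0 \<le> w" using D p by (simp add: w_def field_simps)
    have "A = ketbra (vector [of_real (sqrt p), cnj q / of_real (sqrt p)]) + ketbra (vector [0, of_real (sqrt w)])"
      using p by (simp add: vec_eq_iff forall_2 ketbra_def A sq w)
        (simp add: w_def qq)
    then show ?thesis by blast
  qed
qed

subsection \<open>Vanishing of the Kirkwood--Dirac nonclassicality\<close>

text \<open>A crude bound suffices: it serves to make the sets under the suprema bounded above.
  Overlaps contribute at most 2, matrix elements of \<open>\<rho>\<close> at most 4.\<close>

lemma KD_le:
  assumes "orthonormal_basis e" "orthonormal_basis b" "is_state \<rho>"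
  shows "cmod (KD e b \<rho> i k) \<le> 8"
proof -
  note [simp] = norm_mult
  have le: "cmod x * cmod y \<le> 1" if "cmod x \<le> 1" "cmod y \<le> 1" for x y
    using that by (simp add: mult_le_one)
  have ob: "cmod (b k $ j) \<le> 1" and oe: "cmod (e i $ j) \<le> 1" for j
    using assms orthonormal_basis_component_le by auto
  have 1: "cmod (cinner (b k) (e i)) \<le> 2"
    unfolding cinner_def sum_2
    by (rule order_trans[OF norm_triangle_ineq]) (use le[OF ob oe, of 1 1] le[OF ob oe, of 2 2] in simp)
  have 2: "cmod ((\<rho> *v b k) $ j) \<le> 2" for j
    unfolding matrix_vector_mult_def sum_2 vec_lambda_beta
    by (rule order_trans[OF norm_triangle_ineq])
       (use le[OF state_entry_le[OF assms(3)] ob, of j 1 1] le[OF state_entry_le[OF assms(3)] ob, of j 2 2] in simp)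
  have 3: "cmod (e i $ j) * cmod ((\<rho> *v b k) $ j) \<le> 1 * 2" for j
    by (rule mult_mono) (use oe 2 in auto)
  have 4: "cmod (cinner (e i) (\<rho> *v b k)) \<le> 4"
    unfolding cinner_def sum_2
    by (rule order_trans[OF norm_triangle_ineq]) (use 3[of 1] 3[of 2] in simp)
  have "cmod (cinner (b k) (e i)) * cmod (cinner (e i) (\<rho> *v b k)) \<le> 2 * 4"
    by (rule mult_mono) (use 1 4 in auto)
  then show ?thesis by (simp add: KD_eq)
qed

definition KD_excess :: "(2 \<Rightarrow> qubit_vec) \<Rightarrow> (2 \<Rightarrow> qubit_vec) \<Rightarrow> qubit_op \<Rightarrow> real" where
  "KD_excess e b \<rho> = ((\<Sum>i\<in>UNIV. \<Sum>k\<in>UNIV. cmod (KD e b \<rho> i k)) - 1) / 2"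

lemma N_KD_eq: "N_KD e \<rho> = (SUP b\<in>{b. orthonormal_basis b}. KD_excess e b \<rho>)"
  by (simp add: N_KD_def KD_excess_def)

lemma KD_excess_le:
  assumes "orthonormal_basis e" "orthonormal_basis b" "is_state \<rho>"
  shows "KD_excess e b \<rho> \<le> 16"
  using KD_le[OF assms, of 1 1] KD_le[OF assms, of 1 2] KD_le[OF assms, of 2 1] KD_le[OF assms, of 2 2]
  by (simp add: KD_excess_def sum_2)

text \<open>This is the triangle inequality, since the values sum to 1.\<close>

lemma KD_excess_nonneg:
  assumes "orthonormal_basis e" "orthonormal_basis b" "is_state \<rho>"
  shows "0 \<le> KD_excess e b \<rho>"
proof -
  have "1 = cmod (\<Sum>i\<in>UNIV. \<Sum>k\<in>UNIV. KD e b \<rho> i k)"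
    using assms by (simp add: sum_KD is_state_def)
  also have "\<dots> \<le> (\<Sum>i\<in>UNIV. \<Sum>k\<in>UNIV. cmod (KD e b \<rho> i k))"
    by (intro order_trans[OF norm_sum] sum_mono norm_sum)
  finally show ?thesis by (simp add: KD_excess_def)
qed

lemma KD_excess_le_N_KD:
  assumes "orthonormal_basis e" "orthonormal_basis b" "is_state \<rho>"
  shows "KD_excess e b \<rho> \<le> N_KD e \<rho>"
  unfolding N_KD_eq
  by (rule cSUP_upper) (use assms KD_excess_le in \<open>auto intro!: bdd_aboveI2\<close>)

lemma N_KD_nonneg:
  assumes "orthonormal_basis e" "is_state \<rho>"
  shows "0 \<le> N_KD e \<rho>"
  using KD_excess_nonneg KD_excess_le_N_KD assms order_trans by blast

lemma N_KD_le:
  assumes "orthonormal_basis e" "is_state \<rho>"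
  shows "N_KD e \<rho> \<le> 16"
  unfolding N_KD_eq
  by (rule cSUP_least) (use assms KD_excess_le in auto)

text \<open>Vanishing excess turns the sum of the inequalities \<open>Re z \<le> cmod z\<close> into
  an equality, so each of them is an equality.\<close>

lemma Im_KD_eq_0_if_N_KD_eq_0:
  assumes "orthonormal_basis e" "orthonormal_basis b" "is_state \<rho>" "N_KD e \<rho> = 0"
  shows "Im (KD e b \<rho> i k) = 0"
proof -
  have "KD_excess e b \<rho> \<le> 0"
    using KD_excess_le_N_KD[OF assms(1-3)] assms(4) by simp
  then have "(\<Sum>i\<in>UNIV. \<Sum>k\<in>UNIV. cmod (KD e b \<rho> i k)) \<le> Re (\<Sum>i\<in>UNIV. \<Sum>k\<in>UNIV. KD e b \<rho> i k)"
    using assms(3) by (simp add: KD_excess_def sum_KD[OF assms(1,2)] is_state_def)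
  moreover have le: "Re (KD e b \<rho> i k) \<le> cmod (KD e b \<rho> i k)" for i k
    by (rule complex_Re_le_cmod)
  ultimately have "\<forall>i k. cmod (KD e b \<rho> i k) = Re (KD e b \<rho> i k)"
    using le[of 1 1] le[of 1 2] le[of 2 1] le[of 2 2]
    unfolding forall_2 sum_2 plus_complex.sel by linarith
  then have "cmod (KD e b \<rho> i k) = Re (KD e b \<rho> i k)" by blast
  then show ?thesis
    using cmod_power2[of "KD e b \<rho> i k"] by simp
qed

lemma cinner_add_right: "cinner u (v + w) = cinner u v + cinner u w"
  by (simp add: cinner_def algebra_simps sum.distrib)

lemma cinner_scale_right: "cinner u (c *s v) = c * cinner u v"
  by (simp add: cinner_def sum_distrib_left mult_ac)

lemma cinner_add_left: "cinner (v + w) u = cinner v u + cinner w u"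
  by (simp add: cinner_def algebra_simps sum.distrib)

lemma cinner_scale_left: "cinner (c *s v) u = cnj c * cinner v u"
  by (simp add: cinner_def sum_distrib_left mult_ac)

lemmas cinner_linear = cinner_add_right cinner_scale_right cinner_add_left cinner_scale_left

text \<open>In the rotated basis, \<open>KD e b \<rho> 1 1\<close> is half the sum of a real
  diagonal element and \<open>w * c\<close>, so a nonzero \<open>c\<close> gives it the imaginary
  part \<open>cmod c / 2\<close>.\<close>

lemma N_KD_eq_0_imp_off_diagonal_0:
  assumes e: "orthonormal_basis e" and \<rho>: "is_state \<rho>" and N: "N_KD e \<rho> = 0"
  shows "cinner (e 1) (\<rho> *v e 2) = 0"
proof (rule ccontr)
  define c where "c = cinner (e 1) (\<rho> *v e 2)"
  assume "cinner (e 1) (\<rho> *v e 2) \<noteq> 0"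
  then have c: "c \<noteq> 0" by (simp add: c_def)
  \<comment> \<open>The phase of \<open>w\<close> makes \<open>w * c\<close> purely imaginary.\<close>
  define w where "w = \<i> * cnj c / of_real (cmod c)"
  have cc: "c * cnj c = of_real (cmod c) * of_real (cmod c)"
    using complex_norm_square[of c] by (simp add: power2_eq_square)
  have ww: "w * cnj w = 1"
  proof -
    have "w * cnj w = - (\<i> * \<i>) * (c * cnj c / (of_real (cmod c) * of_real (cmod c)))"
      by (simp add: w_def mult_ac del: i_squared)
    then show ?thesis using c by (simp add: cc)
  qed
  then have ww': "cnj w * w = 1" by (simp add: mult.commute)
  have wc: "w * c = \<i> * of_real (cmod c)"
  proof -
    have "w * c = \<i> * (c * cnj c) / of_real (cmod c)"
      by (simp add: w_def)
    then show ?thesis using c by (simp add: cc)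
  qed
  define s where "s = complex_of_real (1 / sqrt 2)"
  have ss: "s * s = 1 / 2"
    unfolding s_def of_real_mult[symmetric] by simp
  have cs: "cnj s = s" by (simp add: s_def)
  define b :: "2 \<Rightarrow> qubit_vec" where
    "b k = (if k = 1 then s *s (e 1 + w *s e 2) else s *s (e 1 + (- w) *s e 2))" for k
  have ee: "cinner (e i) (e j) = (if i = j then 1 else 0)" for i j
    using e by (simp add: orthonormal_basis_def)
  have b: "orthonormal_basis b"
  proof -
    have *: "cinner (s *s (e 1 + x *s e 2)) (s *s (e 1 + y *s e 2)) = (s * s) * (1 + cnj x * y)" for x y
      by (simp add: cinner_linear ee cs algebra_simps)
    have bb: "b 1 = s *s (e 1 + w *s e 2)" "b 2 = s *s (e 1 + (- w) *s e 2)"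
      by (simp_all add: b_def)
    show ?thesis
      unfolding orthonormal_basis_def forall_2 bb *
      using ww ww' ss by simp
  qed
  have r: "Im (cinner (e 1) (\<rho> *v e 1)) = 0"
  proof -
    have "cnj (cinner (e 1) (\<rho> *v e 1)) = cinner (e 1) (\<rho> *v e 1)"
      using cinner_adjoint[of \<rho> "e 1" "e 1"] \<rho>
      by (simp add: cnj_cinner is_state_def positive_semidef_def)
    then show ?thesis by (simp add: complex_eq_iff)
  qed
  have "KD e b \<rho> 1 1 = (s * s) * (cinner (e 1) (\<rho> *v e 1) + w * c)"
  proof -
    have "cinner (b 1) (e 1) = s" "cinner (e 1) (\<rho> *v b 1) = s * (cinner (e 1) (\<rho> *v e 1) + w * c)"
      by (simp_all add: b_def cinner_linear ee cs c_def matrix_vector_right_distrib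
          vector_scalar_commute distrib_left)
    then show ?thesis by (simp add: KD_eq)
  qed
  then have "Im (KD e b \<rho> 1 1) = cmod c / 2"
    by (simp only: ss wc) (simp add: r)
  with Im_KD_eq_0_if_N_KD_eq_0[OF e b \<rho> N] c show False by simp
qed

text \<open>Each value is an eigenvalue of \<open>\<rho>\<close> times a squared overlap, hence a
  nonnegative real.\<close>

lemma N_KD_eq_0_if_eigenvectors:
  assumes e: "orthonormal_basis e" and \<rho>: "is_state \<rho>"
    and eig: "\<And>i. \<exists>c. \<rho> *v e i = c *s e i"
  shows "N_KD e \<rho> = 0"
proof -
  have "KD_excess e b \<rho> = 0" if b: "orthonormal_basis b" for b
  proof -
    have "cmod (KD e b \<rho> i k) = Re (KD e b \<rho> i k)" for i k
    proof -
      obtain c where c: "\<rho> *v e i = c *s e i" using eig by blast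
      have ee: "cinner (e i) (e i) = 1" using e by (simp add: orthonormal_basis_def)
      have h: "cinner (\<rho> *v u) v = cinner u (\<rho> *v v)" for u v
        using \<rho> by (metis cinner_adjoint is_state_def positive_semidef_def)
      \<comment> \<open>As an expectation value, the eigenvalue is real by hermiticity and
        nonnegative by positivity.\<close>
      have "c = cinner (e i) (\<rho> *v e i)" by (simp add: c cinner_linear ee)
      moreover from this have "cnj c = c" by (metis cnj_cinner h)
      ultimately have c0: "c = of_real (Re c)" "0 \<le> Re c"
        using \<rho> by (auto simp: is_state_def positive_semidef_def complex_eq_iff)
      have "KD e b \<rho> i k = cnj c * (cinner (b k) (e i) * cnj (cinner (b k) (e i)))"
        by (simp add: KD_eq flip: h) (simp add: c cinner_linear cnj_cinner)
      also have "\<dots> = of_real (Re c * (cmod (cinner (b k) (e i)))\<^sup>2)"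
        using \<open>cnj c = c\<close> c0(1) by (simp flip: complex_norm_square)
      finally show ?thesis using c0(2) by (simp add: norm_mult norm_power)
    qed
    then have "(\<Sum>i\<in>UNIV. \<Sum>k\<in>UNIV. cmod (KD e b \<rho> i k)) = Re (\<Sum>i\<in>UNIV. \<Sum>k\<in>UNIV. KD e b \<rho> i k)"
      by simp
    then show ?thesis
      using \<rho> by (simp add: KD_excess_def sum_KD[OF e b] is_state_def)
  qed
  then have "N_KD e \<rho> = (SUP b\<in>{b. orthonormal_basis b}. 0)"
    unfolding N_KD_eq by (intro SUP_cong) auto
  also have "\<dots> = 0" using e by (intro cSUP_const) auto
  finally show ?thesis .
qed

subsection \<open>Steered states\<close>

text \<open>The identity on Bob's side collapses the sum over his intermediate index. Linearity in
  the effect can be read off from this form.\<close>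

lemma ptrace_A_kron_entry:
  "ptrace_A (kron E (mat 1) ** X) $ i $ j = (\<Sum>k\<in>UNIV. \<Sum>l\<in>UNIV. E $ k $ l * X $ (l, i) $ (k, j))"
  unfolding ptrace_A_def kron_def matrix_matrix_mult_def sum_UNIV_prod
  by (simp add: mat_def if_distrib[where f="\<lambda>x. _ * x"] if_distrib[where f="\<lambda>x. x * _"] cong: if_cong)

lemma outcome_prob_eq: "outcome_prob \<rho> E = Re (trace (ptrace_A (kron E (mat 1) ** \<rho>)))"
proof -
  have "trace X = trace (ptrace_A X)" for X :: two_qubit_op
    unfolding trace_def ptrace_A_def sum_UNIV_prod by (simp add: sum_2)
  then show ?thesis by (simp add: outcome_prob_def)
qed

lemma positive_semidef_add:
  "positive_semidef A \<Longrightarrow> positive_semidef B \<Longrightarrow> positive_semidef (A + B)"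
  by (simp add: positive_semidef_def adjoint_mat_def vec_eq_iff matrix_vector_mult_add_rdistrib
      cinner_add_right)

lemma positive_semidef_scaleR:
  "positive_semidef A \<Longrightarrow> 0 \<le> c \<Longrightarrow> positive_semidef (c *\<^sub>R A)"
proof -
  have "cinner v ((c *\<^sub>R A) *v v) = c *\<^sub>R cinner v (A *v v)" for v
    by (simp add: cinner_def matrix_vector_mult_def scaleR_sum_right sum_distrib_left)
  then show "positive_semidef A \<Longrightarrow> 0 \<le> c \<Longrightarrow> positive_semidef (c *\<^sub>R A)"
    by (simp add: positive_semidef_def adjoint_mat_def vec_eq_iff)
qed

text \<open>The quadratic form of the reduced operator at \<open>v\<close> is that of
  \<open>\<rho>\<close> at the product vector of \<open>u\<close> and \<open>v\<close>.\<close>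

lemma positive_semidef_ptrace_ketbra:
  assumes "positive_semidef \<rho>"
  shows "positive_semidef (ptrace_A (kron (ketbra u) (mat 1) ** \<rho>))" (is "positive_semidef ?X")
  unfolding positive_semidef_def
proof (intro conjI allI)
  have h: "cnj (\<rho> $ i $ j) = \<rho> $ j $ i" for i j
    using positive_semidef_entry[OF assms] .
  show "adjoint_mat ?X = ?X"
    by (simp add: vec_eq_iff adjoint_mat_def ptrace_A_kron_entry h ketbra_def sum_2 mult_ac)
  fix v
  define w :: "complex ^ (2 \<times> 2)" where "w = (\<chi> p. u $ fst p * v $ snd p)"
  have "cinner v (?X *v v) = cinner w (\<rho> *v w)"
    by (simp add: cinner_def matrix_vector_mult_def w_def sum_UNIV_prod ptrace_A_kron_entry
        ketbra_def sum_2 algebra_simps)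
  then show "0 \<le> Re (cinner v (?X *v v))"
    using assms by (simp add: positive_semidef_def)
qed

lemma positive_semidef_ptrace:
  assumes "positive_semidef \<rho>" "positive_semidef E"
  shows "positive_semidef (ptrace_A (kron E (mat 1) ** \<rho>))"
proof -
  obtain u v where E: "E = ketbra u + ketbra v"
    using positive_semidef_sum_ketbra[OF assms(2)] by blast
  have "ptrace_A (kron E (mat 1) ** \<rho>) =
      ptrace_A (kron (ketbra u) (mat 1) ** \<rho>) + ptrace_A (kron (ketbra v) (mat 1) ** \<rho>)"
    by (simp add: E vec_eq_iff ptrace_A_kron_entry algebra_simps sum.distrib)
  then show ?thesis
    using assms(1) by (simp add: positive_semidef_add positive_semidef_ptrace_ketbra)
qed

lemma outcome_prob_nonneg:
  assumes "is_state \<rho>" "positive_semidef E"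
  shows "0 \<le> outcome_prob \<rho> E"
  using positive_semidef_diag(2)[OF positive_semidef_ptrace, of \<rho> E] assms
  by (simp add: outcome_prob_eq is_state_def trace_def sum_2)

text \<open>The unnormalized steered operator is positive semidefinite, so its trace is real and
  equals the outcome probability by which it is divided.\<close>

lemma is_state_steered_state:
  assumes "is_state \<rho>" "positive_semidef E" "0 < outcome_prob \<rho> E"
  shows "is_state (steered_state \<rho> E)"
proof -
  define X where "X = ptrace_A (kron E (mat 1) ** \<rho>)"
  have X: "positive_semidef X"
    using assms by (simp add: X_def positive_semidef_ptrace is_state_def)
  have p: "outcome_prob \<rho> E = Re (trace X)"
    by (simp add: X_def outcome_prob_eq)
  have "Im (trace X) = 0"
    using positive_semidef_diag(1)[OF X] by (simp add: trace_def sum_2) (metis Im_complex_of_real add_0)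
  then have "trace X = of_real (outcome_prob \<rho> E)"
    by (simp add: p complex_eq_iff)
  moreover have "trace ((1 / outcome_prob \<rho> E) *\<^sub>R X) = (1 / outcome_prob \<rho> E) *\<^sub>R trace X"
    by (simp add: trace_def scaleR_sum_right)
  ultimately have "trace (steered_state \<rho> E) = 1"
    using assms(3) by (simp add: steered_state_def X_def scaleR_conv_of_real)
  moreover have "positive_semidef (steered_state \<rho> E)"
    using X assms(3) by (simp add: steered_state_def X_def positive_semidef_scaleR)
  ultimately show ?thesis by (simp add: is_state_def)
qed

text \<open>The probability is additive in the effect, and the effects sum to the identity.\<close>

lemma sum_outcome_prob:
  assumes "is_state \<rho>" "is_povm n M"
  shows "(\<Sum>k<n. outcome_prob \<rho> (M k)) = 1"
proof -
  have lin: "outcome_prob \<rho> (\<Sum>k<n. M k) = (\<Sum>k<n. outcome_prob \<rho> (M k))" for n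
  proof (induction n)
    case 0
    show ?case by (simp add: outcome_prob_eq trace_def ptrace_A_kron_entry)
  next
    case (Suc n)
    then show ?case
      by (simp add: outcome_prob_eq trace_def ptrace_A_kron_entry algebra_simps sum.distrib)
  qed
  have "outcome_prob \<rho> (mat 1) = Re (trace \<rho>)"
    unfolding outcome_prob_eq trace_def sum_UNIV_prod ptrace_A_kron_entry sum_2
    by (simp add: mat_def)
  then show ?thesis
    using assms by (simp add: is_povm_def is_state_def flip: lin)
qed

subsection \<open>Bloch coordinates\<close>

lemma pauli_vec_eq:
  "pauli_vec r = vector [vector [of_real (r $ 3), Complex (r $ 1) (- r $ 2)],
                         vector [Complex (r $ 1) (r $ 2), - of_real (r $ 3)]]"
  by (simp add: pauli_vec_def pauli_def sum_3 vec_eq_iff forall_2 complex_eq_iff)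

lemma pauli_vec_scaleR: "pauli_vec (c *\<^sub>R r) = c *\<^sub>R pauli_vec r"
  by (simp add: pauli_vec_def scaleR_sum_right)

text \<open>Without a factor 1/2: a Hermitian \<open>E\<close> is half of
  \<open>Re (trace E) *\<^sub>R mat 1 + pauli_vec (bloch_coord E)\<close>.\<close>

definition bloch_coord :: "qubit_op \<Rightarrow> real ^ 3" where
  "bloch_coord E = (\<chi> i. Re (trace (E ** pauli i)))"

text \<open>Tracing out Alice replaces each operator on her side by the trace of its product with
  \<open>E\<close>: \<open>mat 1\<close> gives \<open>trace E\<close> and \<open>pauli i\<close>
  gives coordinate \<open>i\<close> of \<open>bloch_coord E\<close>.\<close>

lemma ptrace_A_kron_bloch_op:
  assumes "positive_semidef E"
  shows "ptrace_A (kron E (mat 1) ** bloch_op a b T) =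
    (1 / 4) *\<^sub>R ((Re (trace E) + bloch_coord E \<bullet> a) *\<^sub>R mat 1
      + pauli_vec (Re (trace E) *\<^sub>R b + bloch_coord E v* T))"
proof -
  have E: "E $ 1 $ 1 = of_real (Re (E $ 1 $ 1))" "E $ 2 $ 2 = of_real (Re (E $ 2 $ 2))"
      "E $ 2 $ 1 = cnj (E $ 1 $ 2)"
    using positive_semidef_diag(1)[OF assms] positive_semidef_entry[OF assms, of 1 2] by auto
  obtain x y q where xyq: "E $ 1 $ 1 = of_real x" "E $ 2 $ 2 = of_real y" "E $ 1 $ 2 = q"
      "E $ 2 $ 1 = cnj q"
    using E by metis
  have t: "trace E = of_real (x + y)" by (simp add: trace_def sum_2 xyq)
  have c: "bloch_coord E $ 1 = 2 * Re q" "bloch_coord E $ 2 = - 2 * Im q" "bloch_coord E $ 3 = x - y"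
    by (simp_all add: bloch_coord_def trace_def sum_2 matrix_matrix_mult_def pauli_def xyq)
  show ?thesis
    unfolding vec_eq_iff forall_2 ptrace_A_kron_entry sum_2 xyq
    by (simp add: t bloch_op_def kron_def pauli_vec_eq pauli_def sum_3 inner_vec_def c
        vector_matrix_mult_def mat_def complex_eq_iff algebra_simps)
qed

lemma eigen_pauli_vec:
  assumes "eigenbasis (pauli_vec n) e"
  shows "\<exists>c. (s *\<^sub>R mat 1 + t *\<^sub>R pauli_vec n) *v e i = c *s e i"
proof -
  obtain c where c: "pauli_vec n *v e i = c *s e i"
    using assms by (auto simp: eigenbasis_def)
  have 1: "(s *\<^sub>R A) *v v = of_real s *s (A *v v)" for s and A :: qubit_op and v
    by (simp add: matrix_vector_mult_def vec_eq_iff sum_distrib_left)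
       (simp add: scaleR_conv_of_real mult_ac)
  have "(s *\<^sub>R mat 1 + t *\<^sub>R pauli_vec n) *v e i = (of_real s + of_real t * c) *s e i"
    by (simp add: matrix_vector_mult_add_rdistrib 1 c vec_eq_iff algebra_simps)
  then show ?thesis by blast
qed

text \<open>The commutator encodes the cross product of \<open>r\<close> and \<open>n\<close>. When
  this vanishes and \<open>n\<close> is a unit vector, \<open>r\<close> is its own projection onto
  \<open>n\<close>.\<close>

lemma pauli_vec_commute_parallel:
  assumes "pauli_vec r ** pauli_vec n = pauli_vec n ** pauli_vec r" "norm n = 1"
  shows "r = (r \<bullet> n) *\<^sub>R n"
proof -
  have E: "Im ((pauli_vec r ** pauli_vec n) $ 1 $ 1) = r $ 1 * n $ 2 - r $ 2 * n $ 1"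
      "Re ((pauli_vec r ** pauli_vec n) $ 1 $ 2) = r $ 3 * n $ 1 - r $ 1 * n $ 3"
      "Im ((pauli_vec r ** pauli_vec n) $ 1 $ 2) = r $ 2 * n $ 3 - r $ 3 * n $ 2" for r n
    by (simp_all add: pauli_vec_eq matrix_matrix_mult_def sum_2)
  \<comment> \<open>Exchanging \<open>r\<close> and \<open>n\<close> flips the sign of each
    component in \<open>E\<close>, so commutation makes them zero.\<close>
  have 1: "r $ 2 * n $ 3 = r $ 3 * n $ 2" "r $ 1 * n $ 3 = r $ 3 * n $ 1" "r $ 1 * n $ 2 = r $ 2 * n $ 1"
    using E[of r n] E[of n r] unfolding assms(1) by (simp_all only: mult.commute)
  have "n \<bullet> n = 1" using assms(2) by (simp add: norm_eq_1)
  then have 2: "n $ 1 * n $ 1 + n $ 2 * n $ 2 + n $ 3 * n $ 3 = 1"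
    by (simp add: inner_vec_def sum_3)
  show ?thesis
    unfolding vec_eq_iff forall_3 inner_vec_def sum_3 vector_scaleR_component
    using 1 2 unfolding real_scaleR_def inner_real_def by (intro conjI; algebra)
qed

text \<open>Both \<open>\<rho>\<close> and \<open>pauli_vec n\<close> are diagonal in
  \<open>e\<close> and therefore commute; the multiple of the identity drops out of the
  commutator.\<close>

lemma diagonal_imp_parallel:
  assumes e: "eigenbasis (pauli_vec n) e" and n: "norm n = 1"
    and \<rho>: "\<rho> = s *\<^sub>R mat 1 + pauli_vec r"
    and psd: "positive_semidef \<rho>"
    and off: "cinner (e 1) (\<rho> *v e 2) = 0"
  shows "\<exists>c. r = c *\<^sub>R n"
proof -
  define P where "P = pauli_vec n"
  have on: "orthonormal_basis e" using e by (simp add: eigenbasis_def)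
  have ee: "cinner (e i) (e j) = (if i = j then 1 else 0)" for i j
    using on by (simp add: orthonormal_basis_def)
  have h: "cinner (\<rho> *v u) v = cinner u (\<rho> *v v)" for u v
    using psd by (metis cinner_adjoint positive_semidef_def)
  have off': "cinner (e 2) (\<rho> *v e 1) = 0"
    using off by (metis cnj_cinner complex_cnj_zero h)
  have expand: "v = (\<Sum>k\<in>UNIV. cinner (e k) v *s e k)" for v
  proof -
    have "(\<Sum>k\<in>UNIV. ketbra (e k)) *v v = (\<Sum>k\<in>UNIV. cinner (e k) v *s e k)"
      by (simp add: ketbra_def matrix_vector_mult_def vec_eq_iff cinner_def sum_2 algebra_simps)
    then show ?thesis by (simp add: orthonormal_basis_resolution[OF on])
  qed
  have \<rho>e: "\<exists>c. \<rho> *v e i = c *s e i" for i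
    using expand[of "\<rho> *v e i"] exhaust_2[of i] off off' by (auto simp: sum_2)
  have "\<rho> *v (P *v e i) = P *v (\<rho> *v e i)" for i
  proof -
    obtain c where "\<rho> *v e i = c *s e i"
      using \<rho>e by blast
    moreover obtain d where "P *v e i = d *s e i"
      using e by (auto simp: P_def eigenbasis_def)
    ultimately show ?thesis by (simp add: vector_scalar_commute vector_smult_assoc mult.commute)
  qed
  then have "\<rho> *v (P *v v) = P *v (\<rho> *v v)" for v
    by (subst (1 2) expand[of v])
       (simp add: sum_2 matrix_vector_right_distrib vector_scalar_commute)
  then have comm: "\<rho> ** P = P ** \<rho>"
    by (simp add: matrix_eq flip: matrix_vector_mul_assoc)
  have "pauli_vec r ** P = P ** pauli_vec r"
  proof -
    have "(s *\<^sub>R mat 1 + R) ** P = s *\<^sub>R P + R ** P" "P ** (s *\<^sub>R mat 1 + R) = s *\<^sub>R P + P ** R" for R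
      unfolding vec_eq_iff matrix_matrix_mult_def forall_2 sum_2 mat_def
      by (simp_all, simp_all add: scaleR_conv_of_real distrib_right distrib_left mult.commute)
    then show ?thesis using comm unfolding \<rho> by simp
  qed
  then show ?thesis
    using pauli_vec_commute_parallel n unfolding P_def by blast
qed

section \<open>Measurements of the Pauli observables\<close>

lemma positive_semidef_ketbra: "positive_semidef (ketbra v)"
proof -
  have "cinner u (ketbra v *v u) = cinner u v * cnj (cinner u v)" for u
    by (simp add: cinner_def ketbra_def matrix_vector_mult_def sum_2 algebra_simps)
  then have "0 \<le> Re (cinner u (ketbra v *v u))" for u
    by (simp flip: complex_norm_square)
  then show ?thesis
    by (simp add: positive_semidef_def adjoint_mat_def ketbra_def vec_eq_iff mult.commute)
qed

lemma positive_semidef_pauli_effect: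
  assumes "s = 1 \<or> s = - 1"
  shows "positive_semidef ((1 / 2) *\<^sub>R (mat 1 + s *\<^sub>R pauli i))"
proof -
  \<comment> \<open>Unnormalized eigenvectors of \<open>pauli i\<close> for the eigenvalue
    \<open>s\<close>. The third covers both signs by one formula, at the price of squared norm 4
    instead of 2.\<close>
  define v :: "3 \<Rightarrow> qubit_vec" where
    "v i = (if i = 1 then vector [1, of_real s] else if i = 2 then vector [1, \<i> * of_real s]
            else vector [of_real (1 + s), of_real (1 - s)])" for i
  have "ketbra (v i) = (if i = 3 then 2 else 1) *\<^sub>R (mat 1 + s *\<^sub>R pauli i)" for i
    using assms exhaust_3[of i]
    by (auto simp: vec_eq_iff forall_2 ketbra_def v_def pauli_def mat_def)
       (simp_all add: scaleR_conv_of_real)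
  then have "(1 / 2) *\<^sub>R (mat 1 + s *\<^sub>R pauli i) = (if i = 3 then 1 / 4 else 1 / 2) *\<^sub>R ketbra (v i)"
    by simp
  then show ?thesis
    by (simp add: positive_semidef_scaleR positive_semidef_ketbra)
qed

text \<open>Outcome 0 stands for the eigenvalue 1 and outcome 1 for -1; larger indices repeat the
  latter and lie outside the two-outcome POVM.\<close>

definition pauli_povm :: "3 \<Rightarrow> nat \<Rightarrow> qubit_op" where
  "pauli_povm i k = (1 / 2) *\<^sub>R (mat 1 + (if k = 0 then 1 else - 1) *\<^sub>R pauli i)"

lemma positive_semidef_pauli_povm: "positive_semidef (pauli_povm i k)"
  unfolding pauli_povm_def by (rule positive_semidef_pauli_effect) simp

lemma is_povm_pauli_povm: "is_povm 2 (pauli_povm i)"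
  unfolding is_povm_def
proof (intro conjI allI impI)
  show "positive_semidef (pauli_povm i k)" for k
    by (rule positive_semidef_pauli_povm)
  show "(\<Sum>k<2. pauli_povm i k) = mat 1"
    by (simp add: numeral_2_eq_2 pauli_povm_def vec_eq_iff algebra_simps)
qed

lemma trace_pauli_povm: "trace (pauli_povm i k) = 1"
  by (simp add: pauli_povm_def trace_def sum_2 pauli_def mat_def) (simp add: scaleR_conv_of_real)

lemma bloch_coord_pauli_povm:
  "bloch_coord (pauli_povm i k) = (if k = 0 then 1 else - 1) *\<^sub>R axis i 1"
  using exhaust_3[of i]
  by (elim disjE)
     (simp_all add: bloch_coord_def pauli_povm_def vec_eq_iff forall_3 axis_def trace_def sum_2
      matrix_matrix_mult_def pauli_def mat_def)

section \<open>Steered Bloch vectors and the shape of \<open>T\<close>\<close>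

lemma steered_state_bloch_op:
  fixes a b :: "real ^ 3" and T :: "real ^ 3 ^ 3"
  assumes "positive_semidef E"
  defines "c \<equiv> 1 / (4 * outcome_prob (bloch_op a b T) E)"
  shows "steered_state (bloch_op a b T) E =
    (c * (Re (trace E) + bloch_coord E \<bullet> a)) *\<^sub>R mat 1
      + pauli_vec (c *\<^sub>R (Re (trace E) *\<^sub>R b + bloch_coord E v* T))"
  unfolding steered_state_def ptrace_A_kron_bloch_op[OF assms(1)] pauli_vec_scaleR
  by (simp add: c_def scaleR_add_right mult.commute)

text \<open>Both \<open>b\<close> and \<open>bloch_coord E v* T\<close> are multiples of
  \<open>n\<close>, so the steered state has the reference basis as eigenbasis.\<close>

lemma N_KD_steered_state_eq_0:
  assumes "is_state (bloch_op a b T)" "b = \<beta> *\<^sub>R n" "T = (\<chi> i j. d $ i * n $ j)"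
    and e: "eigenbasis (pauli_vec n) e"
    and E: "positive_semidef E" "0 < outcome_prob (bloch_op a b T) E"
  shows "N_KD e (steered_state (bloch_op a b T) E) = 0"
proof (rule N_KD_eq_0_if_eigenvectors)
  show "orthonormal_basis e" using e by (simp add: eigenbasis_def)
  show "is_state (steered_state (bloch_op a b T) E)"
    using assms by (intro is_state_steered_state)
  fix i
  have "bloch_coord E v* T = (bloch_coord E \<bullet> d) *\<^sub>R n"
    by (simp add: assms(3) vector_matrix_mult_def vec_eq_iff inner_vec_def sum_distrib_left mult_ac)
  then have "Re (trace E) *\<^sub>R b + bloch_coord E v* T = (Re (trace E) * \<beta> + bloch_coord E \<bullet> d) *\<^sub>R n"
    by (simp add: assms(2) scaleR_left_distrib)
  then show "\<exists>c. steered_state (bloch_op a b T) E *v e i = c *s e i"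
    unfolding steered_state_bloch_op[OF E(1)] pauli_vec_scaleR scaleR_scaleR
    by (simp only: pauli_vec_scaleR scaleR_scaleR eigen_pauli_vec[OF e])
qed

text \<open>One possible outcome per axis suffices to recover a row of \<open>T\<close>; the same
  fact shows that the set defining \<open>R_KD\<close> is nonempty.\<close>

lemma ex_pauli_povm_outcome_prob_pos:
  assumes "is_state \<rho>"
  shows "\<exists>k<2. 0 < outcome_prob \<rho> (pauli_povm i k)"
proof (rule ccontr)
  assume "\<not> ?thesis"
  then have "(\<Sum>k<2. outcome_prob \<rho> (pauli_povm i k)) \<le> 0"
    by (intro sum_nonpos) auto
  then show False
    using sum_outcome_prob[OF assms is_povm_pauli_povm] by simp
qed

text \<open>A possible outcome on axis \<open>i\<close> steers to a multiple of \<open>b\<close>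
  plus or minus row \<open>i\<close> of \<open>T\<close>. This and \<open>b\<close> are parallel to
  \<open>n\<close>, hence so is the row, and its coefficient is \<open>d $ i\<close>.\<close>

lemma outer_product_if_N_KD_eq_0:
  assumes \<rho>: "is_state (bloch_op a b T)" and b: "b = \<beta> *\<^sub>R n" and n: "norm n = 1"
    and e: "eigenbasis (pauli_vec n) e"
    and N: "\<And>i k. k < 2 \<Longrightarrow> 0 < outcome_prob (bloch_op a b T) (pauli_povm i k) \<Longrightarrow>
      N_KD e (steered_state (bloch_op a b T) (pauli_povm i k)) = 0"
  shows "\<exists>d. T = (\<chi> i j. d $ i * n $ j)"
proof -
  have "\<exists>c. row i T = c *\<^sub>R n" for i
  proof -
    obtain k where k: "k < 2" "0 < outcome_prob (bloch_op a b T) (pauli_povm i k)"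
      using ex_pauli_povm_outcome_prob_pos[OF \<rho>] by blast
    define E where "E = pauli_povm i k"
    define p where "p = outcome_prob (bloch_op a b T) E"
    have E: "positive_semidef E" by (simp add: E_def positive_semidef_pauli_povm)
    have p: "0 < p" using k by (simp add: p_def E_def)
    define \<sigma> where "\<sigma> = steered_state (bloch_op a b T) E"
    have \<sigma>: "is_state \<sigma>"
      unfolding \<sigma>_def using \<rho> E p by (intro is_state_steered_state) (simp_all add: p_def)
    have on: "orthonormal_basis e" using e by (simp add: eigenbasis_def)
    have "N_KD e \<sigma> = 0" using N[OF k] by (simp add: \<sigma>_def E_def)
    then have "cinner (e 1) (\<sigma> *v e 2) = 0"
      using N_KD_eq_0_imp_off_diagonal_0 on \<sigma> by blast
    then obtain c where c: "(1 / (4 * p)) *\<^sub>R (Re (trace E) *\<^sub>R b + bloch_coord E v* T) = c *\<^sub>R n"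
      using diagonal_imp_parallel[OF e n] steered_state_bloch_op[OF E, of a b T] \<sigma>
      unfolding \<sigma>_def p_def is_state_def by metis
    define s :: real where "s = (if k = 0 then 1 else - 1)"
    have "bloch_coord E v* T = s *\<^sub>R row i T"
      by (simp add: E_def bloch_coord_pauli_povm s_def row_def vector_matrix_mult_def vec_eq_iff
          axis_def if_distrib[where f="\<lambda>x. x * _"] if_distrib[where f="\<lambda>x. _ * x"] cong: if_cong)
    moreover have "Re (trace E) = 1" by (simp add: E_def trace_pauli_povm)
    ultimately have "(1 / (4 * p)) *\<^sub>R (\<beta> *\<^sub>R n + s *\<^sub>R row i T) = c *\<^sub>R n"
      using c b by simp
    then have "(4 * p) *\<^sub>R (1 / (4 * p)) *\<^sub>R (\<beta> *\<^sub>R n + s *\<^sub>R row i T) = (4 * p) *\<^sub>R c *\<^sub>R n"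
      by simp
    then have "s *\<^sub>R row i T = (4 * p * c - \<beta>) *\<^sub>R n"
      using p by (simp add: algebra_simps)
    \<comment> \<open>The outcome sign \<open>s\<close> squares to 1, so a second factor
      \<open>s\<close> removes it.\<close>
    then have "s *\<^sub>R s *\<^sub>R row i T = (s * (4 * p * c - \<beta>)) *\<^sub>R n"
      by simp
    then have "row i T = (s * (4 * p * c - \<beta>)) *\<^sub>R n"
      by (simp add: s_def split: if_splits)
    then show ?thesis by blast
  qed
  then obtain d where "\<And>i. row i T = d i *\<^sub>R n" by metis
  then have "T = (\<chi> i j. (\<chi> i. d i) $ i * n $ j)"
    by (simp add: vec_eq_iff row_def)
  then show ?thesis by blast
qed

text \<open>At probability zero \<open>steered_state\<close> divides by zero and yields no state,
  but the zero weight makes the product vanish.\<close>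

lemma weighted_N_KD_bounds:
  assumes "is_state \<rho>" "orthonormal_basis e" "positive_semidef E"
  shows "0 \<le> outcome_prob \<rho> E * N_KD e (steered_state \<rho> E)"
    "outcome_prob \<rho> E * N_KD e (steered_state \<rho> E) \<le> outcome_prob \<rho> E * 16"
proof -
  consider "outcome_prob \<rho> E = 0" | "0 < outcome_prob \<rho> E"
    using outcome_prob_nonneg[OF assms(1,3)] by linarith
  then show "0 \<le> outcome_prob \<rho> E * N_KD e (steered_state \<rho> E)"
    "outcome_prob \<rho> E * N_KD e (steered_state \<rho> E) \<le> outcome_prob \<rho> E * 16"
    using N_KD_nonneg[OF assms(2) is_state_steered_state[OF assms(1,3)]]
      N_KD_le[OF assms(2) is_state_steered_state[OF assms(1,3)]]
    by (cases; simp)+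
qed

subsection \<open>Vanishing of the steered nonclassicality\<close>

lemma Sup_nonneg_eq_0_iff:
  fixes S :: "real set"
  assumes "S \<noteq> {}" "bdd_above S" "\<And>x. x \<in> S \<Longrightarrow> 0 \<le> x"
  shows "Sup S = 0 \<longleftrightarrow> (\<forall>x\<in>S. x = 0)"
proof
  assume "Sup S = 0"
  then show "\<forall>x\<in>S. x = 0"
    using cSup_upper[OF _ assms(2)] assms(3) by (auto intro: antisym)
next
  assume "\<forall>x\<in>S. x = 0"
  with assms(1) have "S = {0}" by auto
  then show "Sup S = 0" by simp
qed

text \<open>The set under the supremum is nonempty, nonnegative and bounded by 16, so its supremum
  vanishes only if all its elements do.\<close>

lemma R_KD_eq_0_iff:
  assumes "is_state \<rho>" "orthonormal_basis e"
  shows "R_KD e \<rho> = 0 \<longleftrightarrow> (\<forall>n M k. is_povm n M \<longrightarrow> k < n \<longrightarrow> 0 < outcome_prob \<rho> (M k) \<longrightarrow>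
    N_KD e (steered_state \<rho> (M k)) = 0)" (is "_ \<longleftrightarrow> ?zero")
proof -
  define S where "S = {N_KD e (steered_state \<rho> (M k)) | n M k.
    is_povm n M \<and> k < n \<and> outcome_prob \<rho> (M k) > 0}"
  have st: "is_state (steered_state \<rho> (M k))"
    if "is_povm n M" "k < n" "0 < outcome_prob \<rho> (M k)" for n M k
    using that is_state_steered_state[OF assms(1)] by (simp add: is_povm_def)
  have bd: "bdd_above S"
    using N_KD_le[OF assms(2) st] by (intro bdd_aboveI[where M = 16]) (auto simp: S_def)
  have nonneg: "0 \<le> x" if "x \<in> S" for x
    using that N_KD_nonneg[OF assms(2) st] by (auto simp: S_def)
  have ne: "S \<noteq> {}"
    using ex_pauli_povm_outcome_prob_pos[OF assms(1), of 1] is_povm_pauli_povm[of 1]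
    by (auto simp: S_def)
  have "Sup S = 0 \<longleftrightarrow> (\<forall>x\<in>S. x = 0)"
    using Sup_nonneg_eq_0_iff[OF ne bd] nonneg by blast
  also have "\<dots> \<longleftrightarrow> ?zero"
    unfolding S_def by blast
  finally show ?thesis by (simp add: R_KD_def S_def)
qed

text \<open>Averages with total weight 1 keep the bound 16, and a sum of nonnegative terms vanishes
  iff each term does. The resulting condition is the one for \<open>R_KD\<close>.\<close>

lemma C_KD_eq_0_iff:
  assumes "is_state \<rho>" "orthonormal_basis e"
  shows "C_KD e \<rho> = 0 \<longleftrightarrow> (\<forall>n M k. is_povm n M \<longrightarrow> k < n \<longrightarrow> 0 < outcome_prob \<rho> (M k) \<longrightarrow>
    N_KD e (steered_state \<rho> (M k)) = 0)" (is "_ \<longleftrightarrow> ?zero")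
proof -
  define f where "f n M = (\<Sum>k<n. outcome_prob \<rho> (M k) * N_KD e (steered_state \<rho> (M k)))"
    for n and M :: "nat \<Rightarrow> qubit_op"
  define S where "S = {f n M | n M. is_povm n M}"
  have summand: "0 \<le> outcome_prob \<rho> (M k) * N_KD e (steered_state \<rho> (M k))"
      "outcome_prob \<rho> (M k) * N_KD e (steered_state \<rho> (M k)) \<le> outcome_prob \<rho> (M k) * 16"
    if "is_povm n M" "k < n" for n M k
    using that weighted_N_KD_bounds[OF assms] by (simp_all add: is_povm_def)
  have "f n M \<le> 16" if "is_povm n M" for n M
  proof -
    have "f n M \<le> (\<Sum>k<n. outcome_prob \<rho> (M k) * 16)"
      unfolding f_def by (intro sum_mono summand(2)[OF that]) simp
    also have "\<dots> = 16"
      by (simp add: sum_outcome_prob[OF assms(1) that] flip: sum_distrib_right)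
    finally show ?thesis .
  qed
  then have bd: "bdd_above S"
    by (intro bdd_aboveI[where M = 16]) (auto simp: S_def)
  have nonneg: "0 \<le> f n M" if "is_povm n M" for n M
    unfolding f_def by (intro sum_nonneg summand(1)[OF that]) simp
  have ne: "S \<noteq> {}"
    using is_povm_pauli_povm by (auto simp: S_def)
  have "Sup S = 0 \<longleftrightarrow> (\<forall>x\<in>S. x = 0)"
    using Sup_nonneg_eq_0_iff[OF ne bd] nonneg by (auto simp: S_def)
  also have "\<dots> \<longleftrightarrow> (\<forall>n M. is_povm n M \<longrightarrow> f n M = 0)"
    unfolding S_def by blast
  also have "\<dots> \<longleftrightarrow> ?zero"
  proof -
    have "f n M = 0 \<longleftrightarrow> (\<forall>k<n. 0 < outcome_prob \<rho> (M k) \<longrightarrow> N_KD e (steered_state \<rho> (M k)) = 0)"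
      if M: "is_povm n M" for n M
    proof -
      have "f n M = 0 \<longleftrightarrow> (\<forall>k<n. outcome_prob \<rho> (M k) * N_KD e (steered_state \<rho> (M k)) = 0)"
        unfolding f_def using summand(1)[OF M] by (subst sum_nonneg_eq_0_iff) auto
      then show ?thesis
        using outcome_prob_nonneg[OF assms(1)] M unfolding is_povm_def
        by (metis less_eq_real_def mult_eq_0_iff order_less_irrefl)
    qed
    then show ?thesis by blast
  qed
  finally show ?thesis by (simp add: C_KD_def S_def f_def)
qed

theorem corollary4:
  fixes \<rho> :: two_qubit_op
    and a b n\<^sub>B :: "real ^ 3"
    and T :: "real ^ 3 ^ 3"
    and e :: "2 \<Rightarrow> qubit_vec"
  assumes "is_state \<rho>"
    and "\<rho> = bloch_op a b T"
    and "b \<noteq> 0"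
    and "n\<^sub>B = b /\<^sub>R norm b"
    and "eigenbasis (pauli_vec n\<^sub>B) e"
  shows "(R_KD e \<rho> = 0 \<longleftrightarrow> (\<exists>d :: real ^ 3. T = (\<chi> i j. d $ i * n\<^sub>B $ j))) \<and>
         (C_KD e \<rho> = 0 \<longleftrightarrow> (\<exists>d :: real ^ 3. T = (\<chi> i j. d $ i * n\<^sub>B $ j)))"
proof -
  have on: "orthonormal_basis e" using assms(5) by (simp add: eigenbasis_def)
  have b: "b = norm b *\<^sub>R n\<^sub>B" and n: "norm n\<^sub>B = 1" using assms(3,4) by simp_all
  \<comment> \<open>This outcome-wise condition characterizes the vanishing of both quantities, so
    one equivalence settles both claims.\<close>
  have "(\<forall>n M k. is_povm n M \<longrightarrow> k < n \<longrightarrow> 0 < outcome_prob \<rho> (M k) \<longrightarrow>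
      N_KD e (steered_state \<rho> (M k)) = 0) \<longleftrightarrow> (\<exists>d. T = (\<chi> i j. d $ i * n\<^sub>B $ j))" (is "?L \<longleftrightarrow> ?R")
  proof
    assume ?L
    then have "N_KD e (steered_state \<rho> (pauli_povm i k)) = 0"
      if "k < 2" "0 < outcome_prob \<rho> (pauli_povm i k)" for i k
      using that is_povm_pauli_povm by blast
    then show ?R
      using outer_product_if_N_KD_eq_0[OF _ b n assms(5)] assms(1,2) by blast
  next
    assume ?R
    then obtain d where d: "T = (\<chi> i j. d $ i * n\<^sub>B $ j)" by blast
    show ?L
      using N_KD_steered_state_eq_0[OF _ b d assms(5)] assms(1,2) by (simp add: is_povm_def)
  qed
  then show ?thesis
    using R_KD_eq_0_iff[OF assms(1) on] C_KD_eq_0_iff[OF assms(1) on] by simp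
qed

end
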